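(* Let $L$ be a distributive lattice with least element $0$. Then the following statements are equivalent. (1) $L$ is disjunctive. (2) $\mathrm{Id}\,L$ is a Martínez frame. (3) $\mathrm{Spec}_d(L)=\mathrm{Spec}(L)$. (4) For all $c\in L$, $\mathrm{id}(c)=\mathrm{id}(c)^{\perp\perp}$. (5) For all $c\in L$, $\mathrm{id}(c)$ is a $d$-element of $\mathrm{Id}\,L$. (6) The set $\mathrm{Min}(L)$ is dense in $\mathrm{Spec}(L)$ with respect to the patch topology. (7) The set $\{U(c): 0<c\in L\}$ is a $\pi$-base for the patch topology on $\mathrm{Spec}(L)$. (8) Distinct compact open subsets of $\mathrm{Spec}(L)$ have distinct closures (with respect to the hull-kernel topology). (9) For all $c\in L$, the lattice $\mathrm{id}(c)$ is disjunctive. (10) For all $I\in\mathrm{Id}\,L$, the lattice $I$ is disjunctive. (11) For all $c\in L$, $\mathrm{id}(c)=\bigcap\{p\in\mathrm{Min}(L): c\in p\}$. (12) For all $a,b\in L$, $\mathrm{id}(a)=\mathrm{id}(b)$ if and only if $\mathrm{id}(a)^{\perp\perp}=\mathrm{id}(b)^{\perp\perp}$.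
   Context: A distributive lattice $L$ with $0$ is disjunctive if for all $a,b\in L$ with $a\nleq b$ there is $c\in L$ with $a\wedge c>0$ and $b\wedge c=0$. $\mathrm{Id}\,L$ is the lattice of all ideals of $L$ ordered by inclusion; it is an algebraic frame in which the meet of any two compact elements is compact (FIP), and its compact elements are the principal ideals $\mathrm{id}(c)=\{x\in L: x\le c\}$. Ideals of $L$ are themselves regarded as distributive lattices with $0$. For $S\subseteq L$, $S^{\perp}=\{b\in L: a\wedge b=0\text{ for all }a\in S\}$, and $c^\perp=\{c\}^\perp$. An ideal $I$ of $L$ is a $d$-element of $\mathrm{Id}\,L$ if $c^{\perp\perp}\subseteq I$ for every $c\in I$. $\mathrm{Id}\,L$ is a Martínez frame if every element of $\mathrm{Id}\,L$ is a $d$-element. $\mathrm{Spec}(L)$ is the set of (proper) prime ideals of $L$, $\mathrm{Spec}_d(L)$ is the set of prime ideals that are $d$-elements, and $\mathrm{Min}(L)$ is the set of minimal prime ideals. For $a\in L$, $U(a)=\{p\in\mathrm{Spec}(L): a\notin p\}$ and $V(a)=\{p\in\mathrm{Spec}(L): a\in p\}$. The hull-kernel topology on $\mathrm{Spec}(L)$ has base $\{U(a):a\in L\}$; the patch topology has base $\{U(a)\cap V(b):a,b\in L\}$. A $\pi$-base of a space is a family of nonempty open sets such that every nonempty open set contains a member of the family. The intersection of an empty family of ideals is $L$. *)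

theory Defs
  imports "HOL-Analysis.Analysis"
begin

text \<open>
  A distributive lattice \<open>L\<close> with least element \<open>0\<close> is a type \<open>'a\<close> of sort
  \<open>{distrib_lattice, order_bot}\<close>: \<open>L\<close> is \<open>UNIV\<close>, \<open>0\<close> is \<open>bot\<close>, meet and join are \<open>inf\<close> and \<open>sup\<close>.
  No greatest element is assumed.
\<close>

text \<open>
  The argument \<open>A\<close> is a sublattice containing \<open>bot\<close>, regarded as a lattice in its own right with the
  inherited operations; the witness \<open>c\<close> has to be found inside \<open>A\<close>.
\<close>
definition disjunctive :: "'a::{distrib_lattice, order_bot} set \<Rightarrow> bool" where
  "disjunctive A \<longleftrightarrow>
     (\<forall>a\<in>A. \<forall>b\<in>A. \<not> a \<le> b \<longrightarrow> (\<exists>c\<in>A. bot < inf a c \<and> inf b c = bot))"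

definition lattice_ideal :: "'a::{distrib_lattice, order_bot} set \<Rightarrow> bool" where
  "lattice_ideal I \<longleftrightarrow>
     I \<noteq> {} \<and> (\<forall>x\<in>I. \<forall>y. y \<le> x \<longrightarrow> y \<in> I) \<and> (\<forall>x\<in>I. \<forall>y\<in>I. sup x y \<in> I)"

definition Idl :: "'a::{distrib_lattice, order_bot} set set" where
  "Idl = {I. lattice_ideal I}"

definition principal_ideal :: "'a::{distrib_lattice, order_bot} \<Rightarrow> 'a set" where
  "principal_ideal c = {x. x \<le> c}"

definition perp :: "'a::{distrib_lattice, order_bot} set \<Rightarrow> 'a set" where
  "perp S = {b. \<forall>a\<in>S. inf a b = bot}"

definition d_element :: "'a::{distrib_lattice, order_bot} set \<Rightarrow> bool" where
  "d_element I \<longleftrightarrow> I \<in> Idl \<and> (\<forall>c\<in>I. perp (perp {c}) \<subseteq> I)"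

text \<open>The type argument carries the lattice: \<open>martinez_Idl TYPE('a)\<close> says that the frame
  \<open>Idl\<close> of ideals of \<open>'a\<close> is a Martinez frame.\<close>
definition martinez_Idl :: "'a::{distrib_lattice, order_bot} itself \<Rightarrow> bool" where
  "martinez_Idl _ \<longleftrightarrow> (\<forall>I\<in>(Idl :: 'a set set). d_element I)"

definition Spec :: "'a::{distrib_lattice, order_bot} set set" where
  "Spec = {p\<in>Idl. p \<noteq> UNIV \<and> (\<forall>a b. inf a b \<in> p \<longrightarrow> a \<in> p \<or> b \<in> p)}"

definition Spec_d :: "'a::{distrib_lattice, order_bot} set set" where
  "Spec_d = {p\<in>Spec. d_element p}"

definition MinSpec :: "'a::{distrib_lattice, order_bot} set set" where
  "MinSpec = {p\<in>Spec. \<forall>q\<in>Spec. q \<subseteq> p \<longrightarrow> q = p}"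

definition spec_U :: "'a::{distrib_lattice, order_bot} \<Rightarrow> 'a set set" where
  "spec_U a = {p\<in>Spec. a \<notin> p}"

definition spec_V :: "'a::{distrib_lattice, order_bot} \<Rightarrow> 'a set set" where
  "spec_V a = {p\<in>Spec. a \<in> p}"

definition hull_kernel :: "'a::{distrib_lattice, order_bot} set topology" where
  "hull_kernel = topology (arbitrary union_of (\<lambda>X. X \<in> {spec_U a |a. True}))"

definition patch :: "'a::{distrib_lattice, order_bot} set topology" where
  "patch = topology (arbitrary union_of (\<lambda>X. X \<in> {spec_U a \<inter> spec_V b |a b. True}))"

definition pi_base :: "'b topology \<Rightarrow> 'b set set \<Rightarrow> bool" where
  "pi_base X \<B> \<longleftrightarrow>
     (\<forall>B\<in>\<B>. openin X B \<and> B \<noteq> {}) \<and>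
     (\<forall>W. openin X W \<and> W \<noteq> {} \<longrightarrow> (\<exists>B\<in>\<B>. B \<subseteq> W))"


lemma lattice_ideal_sublattice:
  assumes "lattice_ideal I"
  shows "bot \<in> I" and "\<And>x y. x \<in> I \<Longrightarrow> y \<in> I \<Longrightarrow> inf x y \<in> I"
    and "\<And>x y. x \<in> I \<Longrightarrow> y \<in> I \<Longrightarrow> sup x y \<in> I"
proof -
  have down: "\<And>x y. x \<in> I \<Longrightarrow> y \<le> x \<Longrightarrow> y \<in> I" and ne: "I \<noteq> {}"
    and sup: "\<And>x y. x \<in> I \<Longrightarrow> y \<in> I \<Longrightarrow> sup x y \<in> I"
    using assms unfolding lattice_ideal_def by auto
  show "bot \<in> I" using ne down bot_least by blast
  show "inf x y \<in> I" if "x \<in> I" "y \<in> I" for x y using down[OF that(1)] by simp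
  show "sup x y \<in> I" if "x \<in> I" "y \<in> I" for x y using sup that .
qed

lemma principal_ideal_in_Idl: "principal_ideal c \<in> Idl"
  unfolding Idl_def lattice_ideal_def principal_ideal_def by (auto intro: order_trans)

lemma Spec_down: "p \<in> Spec \<Longrightarrow> x \<in> p \<Longrightarrow> y \<le> x \<Longrightarrow> y \<in> p"
  unfolding Spec_def Idl_def lattice_ideal_def by blast

lemma Spec_inf_iff:
  assumes "p \<in> Spec"
  shows "inf a b \<in> p \<longleftrightarrow> a \<in> p \<or> b \<in> p"
proof
  show "inf a b \<in> p \<Longrightarrow> a \<in> p \<or> b \<in> p"
    using assms by (simp add: Spec_def)
  show "a \<in> p \<or> b \<in> p \<Longrightarrow> inf a b \<in> p"
    using Spec_down[OF assms _ inf_le1, of a b] Spec_down[OF assms _ inf_le2, of b a] by blast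
qed

lemma Spec_sup_iff:
  assumes "p \<in> Spec"
  shows "sup a b \<in> p \<longleftrightarrow> a \<in> p \<and> b \<in> p"
proof
  show "sup a b \<in> p \<Longrightarrow> a \<in> p \<and> b \<in> p"
    using Spec_down[OF assms _ sup_ge1] Spec_down[OF assms _ sup_ge2] by blast
  show "a \<in> p \<and> b \<in> p \<Longrightarrow> sup a b \<in> p"
    using assms lattice_ideal_sublattice(3)[of p a b] by (simp add: Spec_def Idl_def)
qed

lemma Spec_bot: "p \<in> Spec \<Longrightarrow> bot \<in> p"
  using lattice_ideal_sublattice(1) unfolding Spec_def Idl_def by auto

text \<open>The two families are closed under binary intersection and cover \<open>Spec\<close>, so they are
  bases of topologies on \<open>Spec\<close>.\<close>

lemma spec_U_inf: "spec_U a \<inter> spec_U b = spec_U (inf a b)"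
  by (auto simp: spec_U_def Spec_inf_iff)

lemma spec_V_sup: "spec_V a \<inter> spec_V b = spec_V (sup a b)"
  by (auto simp: spec_V_def Spec_sup_iff)

lemma openin_hull_kernel:
  "openin hull_kernel = arbitrary union_of (\<lambda>X. X \<in> {spec_U a |a. True})"
  unfolding hull_kernel_def
proof (rule topology_inverse', rule istopology_base, clarify)
  fix a b :: 'a
  show "\<exists>c. spec_U a \<inter> spec_U b = spec_U c \<and> True"
    using spec_U_inf by blast
qed

lemma openin_patch:
  "openin patch = arbitrary union_of (\<lambda>X. X \<in> {spec_U a \<inter> spec_V b |a b. True})"
  unfolding patch_def
proof (rule topology_inverse', rule istopology_base, clarify)
  fix a b c d :: 'a
  have "(spec_U a \<inter> spec_V b) \<inter> (spec_U c \<inter> spec_V d) = spec_U (inf a c) \<inter> spec_V (sup b d)"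
    using spec_U_inf[of a c] spec_V_sup[of b d] by blast
  then show "\<exists>e f. (spec_U a \<inter> spec_V b) \<inter> (spec_U c \<inter> spec_V d) = spec_U e \<inter> spec_V f \<and> True"
    by blast
qed

lemma topspace_if_base:
  assumes "openin X = arbitrary union_of (\<lambda>B. B \<in> \<B>)"
  shows "topspace X = \<Union>\<B>"
proof
  show "topspace X \<subseteq> \<Union>\<B>"
    using openin_topspace[of X] unfolding assms union_of_def arbitrary_def by blast
  have "openin X (\<Union>\<B>)"
    unfolding assms union_of_def arbitrary_def by (auto intro!: exI[of _ \<B>])
  then show "\<Union>\<B> \<subseteq> topspace X" by (rule openin_subset)
qed

lemma topspace_hull_kernel: "topspace hull_kernel = (Spec :: 'a::{distrib_lattice, order_bot} set set)"
proof -
  have "p \<in> \<Union>{spec_U a |a. True}" if p: "p \<in> Spec" for p :: "'a set"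
  proof -
    obtain a where "a \<notin> p" using p unfolding Spec_def by blast
    with p show ?thesis unfolding spec_U_def by blast
  qed
  moreover have "\<Union>{spec_U a |a. True} \<subseteq> (Spec :: 'a set set)"
    unfolding spec_U_def by blast
  ultimately show ?thesis
    unfolding topspace_if_base[OF openin_hull_kernel] by (intro equalityI subsetI; blast)
qed

lemma topspace_patch: "topspace patch = (Spec :: 'a::{distrib_lattice, order_bot} set set)"
proof -
  have "p \<in> \<Union>{spec_U a \<inter> spec_V b |a b. True}" if p: "p \<in> Spec" for p :: "'a set"
  proof -
    obtain a where "a \<notin> p" using p unfolding Spec_def by blast
    with p Spec_bot[OF p] show ?thesis unfolding spec_U_def spec_V_def by blast
  qed
  moreover have "\<Union>{spec_U a \<inter> spec_V b |a b. True} \<subseteq> (Spec :: 'a set set)"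
    unfolding spec_U_def by blast
  ultimately show ?thesis
    unfolding topspace_if_base[OF openin_patch] by (intro equalityI subsetI; blast)
qed

end

theory Submission
  imports Defs
begin

text \<open>
  Everything reduces to comparing annihilators: disjunctivity says exactly that
  \<open>b\<^sup>\<bottom> \<subseteq> a\<^sup>\<bottom>\<close> forces \<open>a \<le> b\<close>, that is, \<open>c\<^sup>\<bottom>\<^sup>\<bottom> = id(c)\<close> for all \<open>c\<close>. The
  algebraic conditions (2)--(5), (9), (10), (12) are rewordings of this, using for (3) that prime ideals
  separate \<open>a\<close> from \<open>b\<close> when \<open>a \<nleq> b\<close>, and for (12) that \<open>(a \<squnion> b)\<^sup>\<bottom> = a\<^sup>\<bottom> \<inter> b\<^sup>\<bottom>\<close>.
  For the topological conditions, a prime \<open>p\<close> is minimal only if each \<open>c \<in> p\<close> is disjoint from some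
  \<open>y \<notin> p\<close>; hence \<open>c\<^sup>\<bottom>\<^sup>\<bottom>\<close> is the intersection of the minimal primes containing \<open>c\<close>.
  Finally, the compact open sets are the sets \<open>U(c)\<close>, and \<open>U(a)\<close> and \<open>U(b)\<close> have the same closure iff
  \<open>a\<^sup>\<bottom> = b\<^sup>\<bottom>\<close>.
\<close>

section \<open>Annihilators\<close>

text \<open>The sort of \<open>L\<close> does not include \<open>bounded_lattice_bot\<close>, so the library versions of the next two
  lemmas do not apply.\<close>

lemma inf_bot_iffs [simp]:
  fixes x :: "'a::{distrib_lattice, order_bot}"
  shows "inf x bot = bot" and "inf bot x = bot"
  by (simp_all add: inf_absorb1 inf_absorb2)

lemma sup_eq_bot_iff':
  fixes x y :: "'a::{distrib_lattice, order_bot}"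
  shows "sup x y = bot \<longleftrightarrow> x = bot \<and> y = bot"
  by (metis bot_least le_iff_sup sup.idem sup_ge1 sup_ge2 bot_unique)

lemma inf_eq_bot_mono:
  fixes x y z :: "'a::{distrib_lattice, order_bot}"
  shows "x \<le> y \<Longrightarrow> inf y z = bot \<Longrightarrow> inf x z = bot"
  by (metis bot_unique inf_mono order_refl)

lemma perp_principal_ideal: "perp (principal_ideal c) = perp {c}"
  unfolding perp_def principal_ideal_def by (auto intro: inf_eq_bot_mono)

lemma mem_perp_singleton: "x \<in> perp {c} \<longleftrightarrow> inf c x = bot"
  by (simp add: perp_def)

text \<open>Commutativity of the meet turns membership in a double annihilator into an inclusion of
  annihilators, the form in which disjunctivity is handled below.\<close>

lemma mem_perp_perp: "a \<in> perp (perp {c}) \<longleftrightarrow> perp {c} \<subseteq> perp {a}"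
  unfolding perp_def by (auto simp: inf_commute)

text \<open>\<open>perp\<close> forms an antitone Galois connection with itself, since disjointness
  is symmetric.\<close>

lemma perp_perp_perp: "perp (perp (perp S)) = perp S"
  unfolding perp_def by (auto simp: inf_commute) (metis inf_commute)

lemma perp_perp_eq_iff: "perp (perp S) = perp (perp T) \<longleftrightarrow> perp S = perp T"
  by (metis perp_perp_perp)

lemma perp_mono: "a \<le> b \<Longrightarrow> perp {b} \<subseteq> perp {a}"
  unfolding perp_def by (auto intro: inf_eq_bot_mono)

lemma perp_sup: "perp {sup a b} = perp {a} \<inter> perp {b}"
  unfolding perp_def by (auto simp: inf_sup_distrib2 sup_eq_bot_iff')

text \<open>By contraposition: a witness for \<not> \<open>a \<le> b\<close> is exactly an element
  of \<open>perp {b}\<close> outside \<open>perp {a}\<close>.\<close>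

lemma disjunctive_UNIV_iff:
  "disjunctive (UNIV :: 'a::{distrib_lattice, order_bot} set) \<longleftrightarrow>
     (\<forall>a b::'a. perp {b} \<subseteq> perp {a} \<longrightarrow> a \<le> b)"
  unfolding disjunctive_def perp_def by (auto simp: subset_eq less_le) metis+

lemma disjunctive_UNIV_iff_eq:
  "disjunctive (UNIV :: 'a::{distrib_lattice, order_bot} set) \<longleftrightarrow>
     (\<forall>a b::'a. perp {a} = perp {b} \<longrightarrow> a = b)"
proof
  assume "disjunctive (UNIV :: 'a set)"
  then show "\<forall>a b::'a. perp {a} = perp {b} \<longrightarrow> a = b"
    unfolding disjunctive_UNIV_iff by (simp add: order_eq_iff)
next
  assume inj: "\<forall>a b::'a. perp {a} = perp {b} \<longrightarrow> a = b"
  have "a \<le> b" if "perp {b} \<subseteq> perp {a}" for a b :: 'a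
  proof -
    \<comment> \<open>Passing to \<open>sup a b\<close> turns the inclusion of annihilators into an
      equality, to which injectivity applies.\<close>
    have "perp {sup a b} = perp {b}" using that perp_sup by blast
    then have "sup a b = b" using inj by blast
    then show ?thesis by (metis sup_ge1)
  qed
  then show "disjunctive (UNIV :: 'a set)" unfolding disjunctive_UNIV_iff by blast
qed

section \<open>Prime ideals\<close>

lemma lattice_idealD:
  assumes "lattice_ideal I"
  shows "x \<in> I \<Longrightarrow> y \<le> x \<Longrightarrow> y \<in> I"
  using assms unfolding lattice_ideal_def by blast

lemma lattice_ideal_perp: "lattice_ideal (perp S)"
  unfolding lattice_ideal_def perp_def
  by (auto simp: inf_sup_distrib1 sup_eq_bot_iff' intro: exI[of _ bot])
    (metis inf_commute inf_eq_bot_mono)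

text \<open>This set is the ideal generated by \<open>I\<close> and \<open>a\<close>; it serves to
  enlarge a maximal ideal in the separation theorem.\<close>

lemma lattice_ideal_insert:
  assumes "lattice_ideal I"
  shows "lattice_ideal {z. \<exists>x\<in>I. z \<le> sup x a}"
  unfolding lattice_ideal_def
proof (intro conjI ballI allI impI)
  show "{z. \<exists>x\<in>I. z \<le> sup x a} \<noteq> {}"
    using lattice_ideal_sublattice(1)[OF assms] bot_least by blast
next
  fix u v assume "u \<in> {z. \<exists>x\<in>I. z \<le> sup x a}" "v \<in> {z. \<exists>x\<in>I. z \<le> sup x a}"
  then obtain x y where xy: "x \<in> I" "u \<le> sup x a" "y \<in> I" "v \<le> sup y a" by blast
  have "u \<le> sup (sup x y) a" "v \<le> sup (sup x y) a"
    using xy by (meson order_trans sup_mono sup_ge1 sup_ge2 order_refl)+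
  then have "sup u v \<le> sup (sup x y) a" by simp
  moreover have "sup x y \<in> I" using lattice_ideal_sublattice(3)[OF assms] xy by blast
  ultimately show "sup u v \<in> {z. \<exists>x\<in>I. z \<le> sup x a}" by blast
qed (auto intro: order_trans)

lemma lattice_ideal_Union_chain:
  assumes "C \<noteq> {}" and "\<And>I. I \<in> C \<Longrightarrow> lattice_ideal I"
    and "\<And>I J. I \<in> C \<Longrightarrow> J \<in> C \<Longrightarrow> I \<subseteq> J \<or> J \<subseteq> I"
  shows "lattice_ideal (\<Union>C)"
  unfolding lattice_ideal_def
proof (intro conjI ballI allI impI)
  show "\<Union>C \<noteq> {}" using assms(1,2) lattice_ideal_sublattice(1) by blast
next
  fix x y assume "x \<in> \<Union>C" "y \<le> x"
  then show "y \<in> \<Union>C" using assms(2) lattice_idealD by blast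
next
  fix x y assume "x \<in> \<Union>C" "y \<in> \<Union>C"
  then obtain I where "I \<in> C" "x \<in> I" "y \<in> I" using assms(3) by blast
  then show "sup x y \<in> \<Union>C" using assms(2) lattice_ideal_sublattice(3) by blast
qed

text \<open>Stone's argument: an ideal maximal among those containing \<open>I\<close> and missing
  \<open>M\<close> is prime by distributivity. Stated for meet-closed \<open>M\<close>, it applies
  directly to the set built in \<open>minimal_prime_witness\<close>.\<close>

theorem prime_ideal_separation:
  fixes I M :: "'a::{distrib_lattice, order_bot} set"
  assumes I: "lattice_ideal I" and M: "M \<noteq> {}" "\<And>x y. x \<in> M \<Longrightarrow> y \<in> M \<Longrightarrow> inf x y \<in> M"
    and disj: "I \<inter> M = {}"
  obtains p where "p \<in> Spec" "I \<subseteq> p" "p \<inter> M = {}"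
proof -
  define A where "A = {J. lattice_ideal J \<and> I \<subseteq> J \<and> J \<inter> M = {}}"
  have "\<exists>P\<in>A. \<forall>X\<in>A. P \<subseteq> X \<longrightarrow> X = P"
  proof (rule subset_Zorn_nonempty)
    show "A \<noteq> {}" using I disj unfolding A_def by blast
    fix C assume ne: "C \<noteq> {}" and C: "subset.chain A C"
    then have "lattice_ideal (\<Union>C)"
      by (intro lattice_ideal_Union_chain) (auto simp: subset_chain_def A_def)
    then show "\<Union>C \<in> A" using ne C unfolding A_def subset_chain_def by blast
  qed
  then obtain P where PA: "P \<in> A" and max: "\<And>X. X \<in> A \<Longrightarrow> P \<subseteq> X \<Longrightarrow> X = P"
    by metis
  from PA have P: "lattice_ideal P" "I \<subseteq> P" "P \<inter> M = {}" unfolding A_def by simp_all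
  \<comment> \<open>By maximality, the ideal generated by \<open>P\<close> and an element outside it
    must meet \<open>M\<close>.\<close>
  have meets: "\<exists>x\<in>P. \<exists>m\<in>M. m \<le> sup x a" if "a \<notin> P" for a
  proof (rule ccontr)
    let ?Q = "{z. \<exists>x\<in>P. z \<le> sup x a}"
    assume "\<not> ?thesis"
    moreover have sub: "P \<subseteq> ?Q" by (auto intro: sup_ge1)
    ultimately have "?Q \<in> A" using lattice_ideal_insert[OF P(1)] P(2) unfolding A_def by blast
    then have "?Q = P" using max sub by blast
    moreover have "a \<in> ?Q" using lattice_ideal_sublattice(1)[OF P(1)] by (auto intro: sup_ge2)
    ultimately show False using that by blast
  qed
  have "a \<in> P \<or> b \<in> P" if ab: "inf a b \<in> P" for a b
  proof (rule ccontr)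
    assume "\<not> ?thesis"
    then obtain x m y n where *: "x \<in> P" "m \<in> M" "m \<le> sup x a" "y \<in> P" "n \<in> M" "n \<le> sup y b"
      using meets by meson
    \<comment> \<open>One element of \<open>P\<close> now serves both \<open>a\<close> and
      \<open>b\<close>, and distributivity puts \<open>inf m n\<close> below
      \<open>sup ?z (inf a b)\<close>.\<close>
    let ?z = "sup x y"
    have "m \<le> sup ?z a" "n \<le> sup ?z b"
      using * by (meson order_trans sup_mono sup_ge1 sup_ge2 order_refl)+
    then have "inf m n \<le> sup ?z (inf a b)" by (simp add: sup_inf_distrib1 le_infI1 le_infI2)
    moreover have "sup ?z (inf a b) \<in> P" using * ab lattice_ideal_sublattice(3)[OF P(1)] by blast
    ultimately have "inf m n \<in> P" using lattice_idealD[OF P(1)] by blast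
    then show False using M(2) * P(3) by blast
  qed
  moreover have "P \<noteq> UNIV" using M(1) P(3) by blast
  ultimately have "P \<in> Spec" using P(1) unfolding Spec_def Idl_def by blast
  then show ?thesis using that P by blast
qed

lemma prime_ideal_avoiding:
  assumes "lattice_ideal I" "a \<notin> I"
  obtains p where "p \<in> Spec" "I \<subseteq> p" "a \<notin> p"
  by (rule prime_ideal_separation[OF assms(1), of "{a}"]) (use assms(2) in auto)

lemma prime_separates:
  assumes "\<not> a \<le> b"
  obtains p where "p \<in> Spec" "b \<in> p" "a \<notin> p"
proof -
  have "lattice_ideal (principal_ideal b)" using principal_ideal_in_Idl unfolding Idl_def by blast
  moreover have "a \<notin> principal_ideal b" using assms by (simp add: principal_ideal_def)
  ultimately obtain p where "p \<in> Spec" "principal_ideal b \<subseteq> p" "a \<notin> p"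
    by (rule prime_ideal_avoiding)
  then show ?thesis using that by (auto simp: principal_ideal_def)
qed

section \<open>Minimal prime ideals and double annihilators\<close>

lemma minimal_prime_below:
  fixes p :: "'a::{distrib_lattice, order_bot} set"
  assumes p: "p \<in> Spec"
  obtains q where "q \<in> MinSpec" "q \<subseteq> p"
proof -
  \<comment> \<open>Complements turn minimality into maximality: the union of a chain in
    \<open>A\<close> is the complement of an intersection of a chain of primes, which is again
    prime.\<close>
  define A where "A = uminus ` {q\<in>Spec. q \<subseteq> p}"
  have "\<exists>Q\<in>A. \<forall>X\<in>A. Q \<subseteq> X \<longrightarrow> X = Q"
  proof (rule subset_Zorn_nonempty)
    show "A \<noteq> {}" using p unfolding A_def by blast
    fix C assume ne: "C \<noteq> {}" and C: "subset.chain A C"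
    define q where "q = - \<Union>C"
    have mem: "- X \<in> Spec" "- X \<subseteq> p" if "X \<in> C" for X
      using C that unfolding A_def subset_chain_def by auto
    have lin: "X \<subseteq> Y \<or> Y \<subseteq> X" if "X \<in> C" "Y \<in> C" for X Y
      using C that unfolding subset_chain_def by blast
    have in_q: "x \<in> q \<longleftrightarrow> (\<forall>X\<in>C. x \<in> - X)" for x unfolding q_def by blast
    have "bot \<in> q" using Spec_bot[OF mem(1)] in_q by blast
    moreover have "y \<in> q" if "x \<in> q" "y \<le> x" for x y
      using Spec_down[OF mem(1) _ that(2)] that(1) in_q by blast
    moreover have "sup x y \<in> q" if "x \<in> q" "y \<in> q" for x y
      using Spec_sup_iff[OF mem(1)] that in_q by blast
    ultimately have "lattice_ideal q" unfolding lattice_ideal_def by blast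
    moreover have "q \<subseteq> p" using ne mem(2) unfolding q_def by blast
    moreover have "a \<in> q \<or> b \<in> q" if ab: "inf a b \<in> q" for a b
    proof (rule ccontr)
      assume "\<not> ?thesis"
      then obtain X Y where "X \<in> C" "a \<in> X" "Y \<in> C" "b \<in> Y" unfolding in_q by blast
      \<comment> \<open>The larger of \<open>X\<close> and \<open>Y\<close> contains both elements,
        so both lie outside the single prime \<open>- Z\<close>.\<close>
      then obtain Z where Z: "Z \<in> C" "a \<in> Z" "b \<in> Z" using lin[of X Y] by blast
      have "inf a b \<in> - Z" using ab Z(1) unfolding in_q by blast
      then show False using Spec_inf_iff[OF mem(1)[OF Z(1)], of a b] Z by blast
    qed
    moreover have "q \<noteq> UNIV" using \<open>q \<subseteq> p\<close> p unfolding Spec_def by blast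
    ultimately have "q \<in> {q\<in>Spec. q \<subseteq> p}" unfolding Spec_def Idl_def by simp
    then have "- q \<in> A" unfolding A_def by blast
    then show "\<Union>C \<in> A" unfolding q_def by simp
  qed
  then obtain Q where QA: "Q \<in> A" and max: "\<And>X. X \<in> A \<Longrightarrow> Q \<subseteq> X \<Longrightarrow> X = Q"
    by metis
  from QA obtain q where q: "q \<in> Spec" "q \<subseteq> p" "Q = - q" unfolding A_def by blast
  have "r = q" if "r \<in> Spec" "r \<subseteq> q" for r
  proof -
    have "- r \<in> A" using that q(2) unfolding A_def by blast
    then have "- r = - q" using max[of "- r"] that(2) q(3) by blast
    then show ?thesis by simp
  qed
  with q(1) have "q \<in> MinSpec" unfolding MinSpec_def by blast
  with q that show ?thesis by blast
qed

lemma minimal_prime_avoiding: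
  fixes a :: "'a::{distrib_lattice, order_bot}"
  assumes "a \<noteq> bot"
  obtains p where "p \<in> MinSpec" "a \<notin> p"
proof -
  have "\<not> a \<le> bot" using assms bot_unique by blast
  then obtain p where "p \<in> Spec" "a \<notin> p" by (rule prime_separates)
  then show ?thesis using minimal_prime_below that by blast
qed

text \<open>If no such \<open>y\<close> existed, the multiplicative set generated by \<open>c\<close> and the complement of \<open>p\<close>
  would avoid \<open>bot\<close>, and a prime missing it would lie strictly below \<open>p\<close>.\<close>

lemma minimal_prime_witness:
  fixes p :: "'a::{distrib_lattice, order_bot} set"
  assumes p: "p \<in> MinSpec" and c: "c \<in> p"
  obtains y where "y \<notin> p" "inf c y = bot"
proof (rule ccontr)
  assume "\<not> thesis"
  with that have none: "\<And>y. y \<notin> p \<Longrightarrow> inf c y \<noteq> bot" by blast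
  have pS: "p \<in> Spec" using p unfolding MinSpec_def by blast
  obtain u where u: "u \<notin> p" using pS unfolding Spec_def by blast
  define M where "M = - p \<union> inf c ` (- p)"
  have I: "lattice_ideal {bot :: 'a}" by (auto simp: lattice_ideal_def bot_unique)
  have ne: "M \<noteq> {}" using u unfolding M_def by blast
  have cl: "inf x y \<in> - p" if "x \<in> - p" "y \<in> - p" for x y using that Spec_inf_iff[OF pS] by blast
  have "inf x y \<in> M" if xy: "x \<in> M" "y \<in> M" for x y
  proof -
    obtain x' y' where x': "x' \<in> - p" "x = x' \<or> x = inf c x'" and y': "y' \<in> - p" "y = y' \<or> y = inf c y'"
      using xy unfolding M_def by blast
    have "inf x y = inf x' y' \<or> inf x y = inf c (inf x' y')"
      using x'(2) y'(2) by (auto simp: inf_assoc inf_left_commute)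
    then show ?thesis using cl[OF x'(1) y'(1)] unfolding M_def by auto
  qed
  moreover have "{bot} \<inter> M = {}" using none Spec_bot[OF pS] unfolding M_def by (auto dest: sym)
  ultimately obtain q where q: "q \<in> Spec" "q \<inter> M = {}"
    using prime_ideal_separation[OF I ne] by metis
  have "q \<subseteq> p" using q(2) unfolding M_def by blast
  then have "q = p" using p q(1) unfolding MinSpec_def by blast
  then have "inf c u \<in> q" using c Spec_inf_iff[OF pS] by blast
  then show False using q(2) u unfolding M_def by blast
qed

text \<open>An element of the double annihilator is disjoint from the \<open>y\<close> outside
  \<open>p\<close> given by \<open>minimal_prime_witness\<close>, hence lies in \<open>p\<close>.
  Conversely, if some \<open>y\<close> disjoint from \<open>c\<close> met \<open>x\<close>
  nontrivially, a minimal prime avoiding \<open>inf y x\<close> would contain \<open>c\<close> but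
  not \<open>x\<close>.\<close>

lemma perp_perp_eq_Inter_MinSpec:
  fixes c :: "'a::{distrib_lattice, order_bot}"
  shows "perp (perp {c}) = \<Inter>{p\<in>MinSpec. c \<in> p}"
proof (intro equalityI subsetI)
  fix x assume x: "x \<in> perp (perp {c})"
  have "x \<in> p" if p: "p \<in> MinSpec" "c \<in> p" for p
  proof -
    obtain y where y: "y \<notin> p" "inf c y = bot" using minimal_prime_witness[OF p] by blast
    have pS: "p \<in> Spec" using p unfolding MinSpec_def by blast
    have "inf x y = bot" using x y unfolding perp_def by (auto simp: inf_commute)
    then show "x \<in> p" using Spec_inf_iff[OF pS, of x y] Spec_bot[OF pS] y(1) by simp
  qed
  then show "x \<in> \<Inter>{p\<in>MinSpec. c \<in> p}" by blast
next
  fix x assume x: "x \<in> \<Inter>{p\<in>MinSpec. c \<in> p}"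
  have "inf y x = bot" if y: "inf c y = bot" for y
  proof (rule ccontr)
    assume "inf y x \<noteq> bot"
    then obtain p where p: "p \<in> MinSpec" "inf y x \<notin> p" by (rule minimal_prime_avoiding)
    have pS: "p \<in> Spec" using p unfolding MinSpec_def by blast
    have "c \<in> p" using Spec_inf_iff[OF pS] Spec_bot[OF pS] y p(2) by metis
    then show False using x p Spec_inf_iff[OF pS] by blast
  qed
  then show "x \<in> perp (perp {c})" unfolding perp_def by blast
qed

section \<open>The topologies on the spectrum\<close>

text \<open>Separation by primes makes \<open>spec_U\<close> an order embedding, so a basic open set
  determines its element.\<close>

lemma spec_U_subset_iff: "spec_U a \<subseteq> spec_U b \<longleftrightarrow> a \<le> b"
proof
  show "spec_U a \<subseteq> spec_U b \<Longrightarrow> a \<le> b"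
    unfolding spec_U_def using prime_separates[of a b] by blast
  show "a \<le> b \<Longrightarrow> spec_U a \<subseteq> spec_U b"
    unfolding spec_U_def using Spec_down by blast
qed

lemma spec_U_eq_iff: "spec_U a = spec_U b \<longleftrightarrow> a = b"
  by (simp add: set_eq_subset spec_U_subset_iff order_eq_iff)

lemma spec_U_bot: "spec_U bot = {}"
  unfolding spec_U_def using Spec_bot by blast

lemma spec_V_bot: "spec_V bot = Spec"
  unfolding spec_V_def using Spec_bot by blast

lemma spec_U_sup: "spec_U (sup a b) = spec_U a \<union> spec_U b"
  unfolding spec_U_def using Spec_sup_iff by blast

lemma spec_U_eq_empty_iff: "spec_U a = {} \<longleftrightarrow> a = bot"
  using spec_U_eq_iff[of a bot] by (simp add: spec_U_bot)

text \<open>This translates the hypothesis of disjunctivity into nonemptiness of a basic patch-open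
  set.\<close>

lemma patch_basic_nonempty_iff: "spec_U a \<inter> spec_V b \<noteq> {} \<longleftrightarrow> \<not> a \<le> b"
proof -
  have "spec_U a \<inter> spec_V b = spec_U a - spec_U b" unfolding spec_U_def spec_V_def by blast
  then show ?thesis by (simp add: spec_U_subset_iff)
qed

lemma openin_hull_kernel_iff:
  "openin hull_kernel W \<longleftrightarrow> W \<subseteq> Spec \<and> (\<forall>p\<in>W. \<exists>a. p \<in> spec_U a \<and> spec_U a \<subseteq> W)"
proof -
  have "openin hull_kernel W \<longleftrightarrow> (\<forall>p\<in>W. \<exists>a. p \<in> spec_U a \<and> spec_U a \<subseteq> W)"
    unfolding openin_hull_kernel arbitrary_union_of_alt by blast
  then show ?thesis using openin_subset[of hull_kernel W] topspace_hull_kernel by blast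
qed

lemma openin_patch_iff:
  "openin patch W \<longleftrightarrow> (\<forall>p\<in>W. \<exists>a b. p \<in> spec_U a \<inter> spec_V b \<and> spec_U a \<inter> spec_V b \<subseteq> W)"
  unfolding openin_patch arbitrary_union_of_alt by blast

lemma openin_hull_kernel_spec_U: "openin hull_kernel (spec_U a)"
  unfolding openin_hull_kernel_iff by (auto simp: spec_U_def)

lemma openin_patch_basic: "openin patch (spec_U a \<inter> spec_V b)"
  unfolding openin_patch_iff by blast

lemma openin_patch_spec_U: "openin patch (spec_U a)"
proof -
  have "spec_U a = spec_U a \<inter> spec_V bot" unfolding spec_V_bot spec_U_def by blast
  then show ?thesis using openin_patch_basic by metis
qed

text \<open>A basic neighbourhood \<open>spec_U x\<close> misses \<open>spec_U a\<close> iff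
  \<open>inf a x = bot\<close>, so \<open>p\<close> lies in the closure iff no \<open>x\<close>
  outside \<open>p\<close> annihilates \<open>a\<close>.\<close>

lemma closure_of_spec_U:
  "hull_kernel closure_of spec_U a = {p\<in>Spec. perp {a} \<subseteq> p}"
proof -
  have meets: "(\<exists>q. q \<in> spec_U a \<and> q \<in> spec_U x) \<longleftrightarrow> x \<notin> perp {a}" for x
    using spec_U_eq_empty_iff[of "inf a x"] unfolding mem_perp_singleton spec_U_inf[symmetric] by blast
  have "p \<in> hull_kernel closure_of spec_U a \<longleftrightarrow> perp {a} \<subseteq> p" if p: "p \<in> Spec" for p
  proof
    assume "p \<in> hull_kernel closure_of spec_U a"
    then have "x \<notin> perp {a}" if "p \<in> spec_U x" for x
      unfolding meets[symmetric] in_closure_of using that openin_hull_kernel_spec_U by blast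
    then show "perp {a} \<subseteq> p" using p unfolding spec_U_def by blast
  next
    assume sub: "perp {a} \<subseteq> p"
    have "\<exists>q. q \<in> spec_U a \<and> q \<in> W" if W: "p \<in> W" "openin hull_kernel W" for W
    proof -
      obtain x where x: "p \<in> spec_U x" "spec_U x \<subseteq> W" using W unfolding openin_hull_kernel_iff by blast
      have "x \<notin> perp {a}" using x(1) sub unfolding spec_U_def by blast
      then show ?thesis using x(2) unfolding meets[symmetric] by blast
    qed
    then show "p \<in> hull_kernel closure_of spec_U a"
      unfolding in_closure_of topspace_hull_kernel using p by blast
  qed
  then show ?thesis
    using closure_of_subset_topspace[of hull_kernel "spec_U a"] unfolding topspace_hull_kernel by blast
qed

text \<open>The ideal \<open>perp {a}\<close> is recovered from the closure as the intersection of
  the primes containing it.\<close>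

lemma closure_of_spec_U_eq_iff:
  "hull_kernel closure_of spec_U a = hull_kernel closure_of spec_U b \<longleftrightarrow> perp {a} = perp {b}"
proof -
  have le: "perp {b} \<subseteq> perp {a}" if "{p\<in>Spec. perp {a} \<subseteq> p} \<subseteq> {p\<in>Spec. perp {b} \<subseteq> p}"
    for a b :: 'a
  proof
    fix x assume x: "x \<in> perp {b}"
    show "x \<in> perp {a}"
    proof (rule ccontr)
      assume "x \<notin> perp {a}"
      then obtain p where "p \<in> Spec" "perp {a} \<subseteq> p" "x \<notin> p"
        using prime_ideal_avoiding[OF lattice_ideal_perp] by metis
      then show False using that x by blast
    qed
  qed
  from le[of a b] le[of b a] show ?thesis unfolding closure_of_spec_U by (intro iffI equalityI) simp_all
qed

section \<open>Compact open subsets in the hull-kernel topology\<close>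

lemma Union_spec_U_finite:
  assumes "finite F"
  shows "\<exists>c. \<Union>(spec_U ` F) = spec_U c"
  using assms
proof (induction F)
  case empty
  show ?case using spec_U_bot by auto
next
  case (insert a F)
  then show ?case using spec_U_sup by (metis Union_insert image_insert)
qed

lemma compact_open_is_spec_U:
  assumes K: "compactin hull_kernel K" "openin hull_kernel K"
  obtains c where "K = spec_U c"
proof -
  let ?F = "spec_U ` {a. spec_U a \<subseteq> K}"
  have "K \<subseteq> \<Union>?F" using K(2) unfolding openin_hull_kernel_iff by blast
  moreover have "openin hull_kernel X" if "X \<in> ?F" for X
    using that openin_hull_kernel_spec_U by blast
  ultimately obtain G where G: "finite G" "G \<subseteq> ?F" "K \<subseteq> \<Union>G"
    using K(1) unfolding compactin_def by meson
  then obtain S where S: "S \<subseteq> {a. spec_U a \<subseteq> K}" "finite S" "G = spec_U ` S"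
    by (meson finite_subset_image)
  then have "K = \<Union>(spec_U ` S)" using G by blast
  then show ?thesis using Union_spec_U_finite[OF S(2)] that by metis
qed

lemma compactin_spec_U: "compactin hull_kernel (spec_U a)"
  unfolding compactin_def
proof (intro conjI allI impI)
  show "spec_U a \<subseteq> topspace hull_kernel" unfolding topspace_hull_kernel spec_U_def by blast
next
  fix \<U> assume U: "Ball \<U> (openin hull_kernel) \<and> spec_U a \<subseteq> \<Union>\<U>"
  \<comment> \<open>The elements whose basic open set is finitely covered form an ideal. A prime
    above \<open>J\<close> avoiding \<open>a\<close> would lie in some member of the cover, and a
    basic neighbourhood \<open>spec_U x\<close> inside that member would put \<open>x\<close> in
    \<open>J\<close> but outside the prime.\<close>
  define J where "J = {x. \<exists>F. finite F \<and> F \<subseteq> \<U> \<and> spec_U x \<subseteq> \<Union>F}"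
  have "lattice_ideal J"
    unfolding lattice_ideal_def
  proof (intro conjI ballI allI impI)
    have "bot \<in> J" unfolding J_def by (auto simp: spec_U_bot intro: exI[of _ "{}"])
    then show "J \<noteq> {}" by blast
  next
    fix x y assume "x \<in> J" "y \<le> x"
    from \<open>x \<in> J\<close> obtain F where "finite F" "F \<subseteq> \<U>" "spec_U x \<subseteq> \<Union>F"
      unfolding J_def mem_Collect_eq by metis
    moreover have "spec_U y \<subseteq> spec_U x" using \<open>y \<le> x\<close> by (simp add: spec_U_subset_iff)
    ultimately have "finite F \<and> F \<subseteq> \<U> \<and> spec_U y \<subseteq> \<Union>F" by simp
    then show "y \<in> J" unfolding J_def by blast
  next
    fix x y assume "x \<in> J" "y \<in> J"
    then obtain F G where "finite F" "F \<subseteq> \<U>" "spec_U x \<subseteq> \<Union>F" "finite G" "G \<subseteq> \<U>" "spec_U y \<subseteq> \<Union>G"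
      unfolding J_def mem_Collect_eq by metis
    then have "finite (F \<union> G) \<and> F \<union> G \<subseteq> \<U> \<and> spec_U (sup x y) \<subseteq> \<Union>(F \<union> G)"
      unfolding spec_U_sup by auto
    then show "sup x y \<in> J" unfolding J_def by blast
  qed
  moreover have False if p: "p \<in> Spec" "J \<subseteq> p" "a \<notin> p" for p
  proof -
    obtain W where W: "W \<in> \<U>" "p \<in> W" using p U unfolding spec_U_def by blast
    then have "openin hull_kernel W" using U by blast
    then obtain x where x: "p \<in> spec_U x" "spec_U x \<subseteq> W"
      using W(2) unfolding openin_hull_kernel_iff by blast
    have "x \<in> J" unfolding J_def using W(1) x(2) by (auto intro!: exI[of _ "{W}"])
    then show False using p x(1) unfolding spec_U_def by blast
  qed
  ultimately have "a \<in> J" using prime_ideal_avoiding by metis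
  then show "\<exists>\<F>. finite \<F> \<and> \<F> \<subseteq> \<U> \<and> spec_U a \<subseteq> \<Union>\<F>" unfolding J_def by simp
qed

section \<open>Characterizations of disjunctivity\<close>

text \<open>By \<open>perp_mono\<close>, a principal ideal always lies in its double annihilator;
  the reverse inclusion is disjunctivity.\<close>

lemma disjunctive_iff_perp_perp:
  "disjunctive (UNIV :: 'a::{distrib_lattice, order_bot} set) \<longleftrightarrow>
     (\<forall>c::'a. principal_ideal c = perp (perp (principal_ideal c)))"
proof -
  have "principal_ideal c = perp (perp (principal_ideal c)) \<longleftrightarrow>
      (\<forall>a. a \<le> c \<longleftrightarrow> perp {c} \<subseteq> perp {a})" for c :: 'a
    unfolding set_eq_iff perp_principal_ideal mem_perp_perp by (simp add: principal_ideal_def)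
  then show ?thesis
    unfolding disjunctive_UNIV_iff using perp_mono by metis
qed

lemma disjunctive_iff_martinez:
    "disjunctive (UNIV :: 'a::{distrib_lattice, order_bot} set) \<longleftrightarrow> martinez_Idl TYPE('a)" (is "?D \<longleftrightarrow> ?M")
  and disjunctive_iff_Spec_d: "disjunctive (UNIV :: 'a set) \<longleftrightarrow> (Spec_d :: 'a set set) = Spec" (is "?D \<longleftrightarrow> ?S")
  and disjunctive_iff_principal_d: "disjunctive (UNIV :: 'a set) \<longleftrightarrow> (\<forall>c::'a. d_element (principal_ideal c))"
    (is "?D \<longleftrightarrow> ?P")
proof -
  have DM: ?M if ?D
    unfolding martinez_Idl_def d_element_def
  proof (intro ballI conjI subsetI)
    fix I and c x :: 'a assume I: "I \<in> Idl" "c \<in> I" and "x \<in> perp (perp {c})"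
    then have "x \<le> c" using that unfolding disjunctive_UNIV_iff mem_perp_perp by blast
    then show "x \<in> I" using I unfolding Idl_def by (auto intro: lattice_idealD)
  qed
  have MS: ?S if ?M
    using that unfolding martinez_Idl_def Spec_d_def by (auto simp: Spec_def)
  have MP: ?P if ?M
    using that principal_ideal_in_Idl unfolding martinez_Idl_def by blast
  have SD: ?D if ?S
    unfolding disjunctive_UNIV_iff
  proof (intro allI impI, rule ccontr)
    fix a b :: 'a
    assume ab: "perp {b} \<subseteq> perp {a}" and "\<not> a \<le> b"
    then obtain p where "p \<in> Spec" "b \<in> p" "a \<notin> p" using prime_separates by metis
    moreover from this have "d_element p" using that unfolding Spec_d_def by blast
    ultimately show False using ab unfolding d_element_def mem_perp_perp[symmetric] by blast
  qed
  have PD: ?D if ?P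
    unfolding disjunctive_UNIV_iff mem_perp_perp[symmetric]
  proof (intro allI impI)
    fix a b :: 'a assume "a \<in> perp (perp {b})"
    moreover have "b \<in> principal_ideal b" by (simp add: principal_ideal_def)
    ultimately have "a \<in> principal_ideal b" using that unfolding d_element_def by blast
    then show "a \<le> b" by (simp add: principal_ideal_def)
  qed
  show "?D \<longleftrightarrow> ?M" "?D \<longleftrightarrow> ?S" "?D \<longleftrightarrow> ?P" using DM MS MP SD PD by blast+
qed

lemma disjunctive_iff_pi_base:
    "disjunctive (UNIV :: 'a::{distrib_lattice, order_bot} set) \<longleftrightarrow> pi_base patch {spec_U c |c::'a. bot < c}"
    (is "?D \<longleftrightarrow> ?B")
  and disjunctive_iff_MinSpec_dense:
    "disjunctive (UNIV :: 'a set) \<longleftrightarrow> patch closure_of (MinSpec :: 'a set set) = Spec" (is "?D \<longleftrightarrow> ?M")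
proof -
  have DB: ?B if D: ?D
    unfolding pi_base_def
  proof (intro conjI ballI allI impI)
    fix B assume "B \<in> {spec_U c |c::'a. bot < c}"
    then show "openin patch B" "B \<noteq> {}"
      using openin_patch_spec_U by (auto simp: spec_U_eq_empty_iff)
  next
    fix W :: "'a set set" assume W: "openin patch W \<and> W \<noteq> {}"
    then obtain p where "p \<in> W" by blast
    with W obtain a b where ab: "p \<in> spec_U a \<inter> spec_V b" "spec_U a \<inter> spec_V b \<subseteq> W"
      unfolding openin_patch_iff by meson
    then have "\<not> a \<le> b" using patch_basic_nonempty_iff by blast
    then obtain c where c: "bot < inf a c" "inf b c = bot" using D unfolding disjunctive_def by blast
    \<comment> \<open>Since \<open>c\<close> is disjoint from \<open>b\<close>, every prime omitting
      \<open>c\<close> contains \<open>b\<close>; so \<open>spec_U (inf a c)\<close> already lies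
      inside the given basic patch-open set.\<close>
    have "spec_U b \<inter> spec_U c = {}" by (simp add: spec_U_inf c(2) spec_U_bot)
    then have "spec_U a \<inter> spec_U c \<subseteq> spec_V b" unfolding spec_U_def spec_V_def by blast
    then have "spec_U (inf a c) \<subseteq> W" using ab(2) unfolding spec_U_inf[symmetric] by blast
    then show "\<exists>B\<in>{spec_U c |c::'a. bot < c}. B \<subseteq> W" using c(1) by blast
  qed
  have BM: ?M if B: ?B
  proof -
    have "\<exists>q\<in>MinSpec. q \<in> W" if "openin patch W" "W \<noteq> {}" for W :: "'a set set"
    proof -
      obtain c where c: "bot < c" "spec_U c \<subseteq> W" using B \<open>openin patch W\<close> \<open>W \<noteq> {}\<close> unfolding pi_base_def by blast
      obtain q where "q \<in> MinSpec" "c \<notin> q" using minimal_prime_avoiding c(1) by (metis less_le)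
      then show ?thesis using c(2) unfolding MinSpec_def spec_U_def by blast
    qed
    then show ?thesis unfolding closure_of_def topspace_patch by blast
  qed
  have MD: ?D if M: ?M
    unfolding disjunctive_def
  proof (intro ballI impI)
    fix a b :: 'a assume "\<not> a \<le> b"
    then obtain p where "p \<in> spec_U a \<inter> spec_V b" using patch_basic_nonempty_iff by blast
    moreover from this have "p \<in> patch closure_of MinSpec" using M unfolding spec_U_def by blast
    ultimately obtain q where q: "q \<in> MinSpec" "q \<in> spec_U a \<inter> spec_V b"
      using openin_patch_basic unfolding in_closure_of by blast
    then have qS: "q \<in> Spec" "a \<notin> q" "b \<in> q" unfolding spec_U_def spec_V_def by auto
    \<comment> \<open>Minimality of \<open>q\<close> supplies the disjunctivity witness:
      \<open>a\<close> and \<open>c\<close> both lie outside \<open>q\<close>, so their meet does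
      too and is nonzero.\<close>
    then obtain c where c: "c \<notin> q" "inf b c = bot" using minimal_prime_witness q(1) by metis
    have "inf a c \<notin> q" using Spec_inf_iff[OF qS(1)] c(1) qS(2) by blast
    then have "bot < inf a c" using Spec_bot[OF qS(1)] by (metis bot_least less_le)
    then show "\<exists>c\<in>UNIV. bot < inf a c \<and> inf b c = bot" using c(2) by blast
  qed
  show "?D \<longleftrightarrow> ?B" "?D \<longleftrightarrow> ?M" using DB BM MD by blast+
qed

text \<open>With compact open sets identified as the \<open>spec_U c\<close>, the claim is
  injectivity of the map sending \<open>a\<close> to \<open>perp {a}\<close>.\<close>

lemma disjunctive_iff_compact_open_closures:
  "disjunctive (UNIV :: 'a::{distrib_lattice, order_bot} set) \<longleftrightarrow>
     (\<forall>K K' :: 'a set set. compactin hull_kernel K \<and> openin hull_kernel K \<and>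
         compactin hull_kernel K' \<and> openin hull_kernel K' \<and> K \<noteq> K' \<longrightarrow>
         hull_kernel closure_of K \<noteq> hull_kernel closure_of K')"
proof -
  have "compactin hull_kernel K \<and> openin hull_kernel K \<longleftrightarrow> (\<exists>c. K = spec_U c)" for K :: "'a set set"
    using compact_open_is_spec_U compactin_spec_U openin_hull_kernel_spec_U by metis
  then show ?thesis
    unfolding disjunctive_UNIV_iff_eq closure_of_spec_U_eq_iff[symmetric]
    by (metis spec_U_eq_iff)
qed

lemma disjunctive_iff_principal_disjunctive:
    "disjunctive (UNIV :: 'a::{distrib_lattice, order_bot} set) \<longleftrightarrow> (\<forall>c::'a. disjunctive (principal_ideal c))"
    (is "?D \<longleftrightarrow> ?P")
  and disjunctive_iff_ideals_disjunctive:
    "disjunctive (UNIV :: 'a set) \<longleftrightarrow> (\<forall>I \<in> (Idl :: 'a set set). disjunctive I)" (is "?D \<longleftrightarrow> ?I")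
proof -
  have DI: ?I if D: ?D
    unfolding disjunctive_def
  proof (intro ballI impI)
    fix I and a b :: 'a assume I: "I \<in> Idl" "a \<in> I" and "\<not> a \<le> b"
    then obtain c where c: "bot < inf a c" "inf b c = bot" using D unfolding disjunctive_def by blast
    \<comment> \<open>The witness \<open>c\<close> may lie outside \<open>I\<close>;
      \<open>inf a c\<close> lies below \<open>a\<close> and still works.\<close>
    have "inf a c \<in> I" using I by (auto simp: Idl_def intro: lattice_idealD)
    moreover have "inf a (inf a c) = inf a c" "inf b (inf a c) = bot"
      using c(2) by (simp_all add: inf_left_commute[of b])
    ultimately show "\<exists>c\<in>I. bot < inf a c \<and> inf b c = bot" using c(1) by metis
  qed
  have IP: ?P if ?I using that principal_ideal_in_Idl by blast
  \<comment> \<open>Any two elements lie together in the principal ideal of their join.\<close>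
  have PD: ?D if ?P
    using that unfolding disjunctive_def principal_ideal_def by (metis UNIV_I mem_Collect_eq sup_ge1 sup_ge2)
  show "?D \<longleftrightarrow> ?P" "?D \<longleftrightarrow> ?I" using DI IP PD by blast+
qed

lemma disjunctive_iff_Inter_MinSpec:
  "disjunctive (UNIV :: 'a::{distrib_lattice, order_bot} set) \<longleftrightarrow>
     (\<forall>c::'a. principal_ideal c = \<Inter>{p \<in> MinSpec. c \<in> p})"
  unfolding disjunctive_iff_perp_perp perp_principal_ideal perp_perp_eq_Inter_MinSpec ..

lemma disjunctive_iff_perp_perp_inj:
  "disjunctive (UNIV :: 'a::{distrib_lattice, order_bot} set) \<longleftrightarrow>
     (\<forall>a b :: 'a. principal_ideal a = principal_ideal b \<longleftrightarrow>
        perp (perp (principal_ideal a)) = perp (perp (principal_ideal b)))"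
proof -
  have "principal_ideal a = principal_ideal b \<longleftrightarrow> a = b" for a b :: 'a
    unfolding principal_ideal_def by (auto simp: set_eq_iff intro: order.antisym)
  then show ?thesis
    unfolding disjunctive_UNIV_iff_eq perp_perp_eq_iff perp_principal_ideal by auto
qed

theorem theorem3p1:
  shows "let statements =
    [ disjunctive (UNIV :: 'a::{distrib_lattice, order_bot} set),
      martinez_Idl TYPE('a),
      (Spec_d :: 'a set set) = Spec,
      \<forall>c::'a. principal_ideal c = perp (perp (principal_ideal c)),
      \<forall>c::'a. d_element (principal_ideal c),
      patch closure_of (MinSpec :: 'a set set) = Spec,
      pi_base patch {spec_U c |c::'a. bot < c},
      \<forall>K K' :: 'a set set. compactin hull_kernel K \<and> openin hull_kernel K \<and>
         compactin hull_kernel K' \<and> openin hull_kernel K' \<and> K \<noteq> K' \<longrightarrow>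
         hull_kernel closure_of K \<noteq> hull_kernel closure_of K',
      \<forall>c::'a. disjunctive (principal_ideal c),
      \<forall>I \<in> (Idl :: 'a set set). disjunctive I,
      \<forall>c::'a. principal_ideal c = \<Inter>{p \<in> MinSpec. c \<in> p},
      \<forall>a b :: 'a. principal_ideal a = principal_ideal b \<longleftrightarrow>
         perp (perp (principal_ideal a)) = perp (perp (principal_ideal b)) ]
    in \<forall>P \<in> set statements. \<forall>Q \<in> set statements. P \<longleftrightarrow> Q"
  \<comment> \<open>Every entry is rewritten to disjunctivity, after which each pairwise equivalence
    is reflexive.\<close>
  unfolding Let_def
  by (simp only: list.set ball_simps simp_thms
      disjunctive_iff_martinez[symmetric] disjunctive_iff_Spec_d[symmetric]
      disjunctive_iff_perp_perp[symmetric] disjunctive_iff_principal_d[symmetric]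
      disjunctive_iff_MinSpec_dense[symmetric] disjunctive_iff_pi_base[symmetric]
      disjunctive_iff_compact_open_closures[symmetric]
      disjunctive_iff_principal_disjunctive[symmetric]
      disjunctive_iff_ideals_disjunctive[symmetric]
      disjunctive_iff_Inter_MinSpec[symmetric] disjunctive_iff_perp_perp_inj[symmetric])

end
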